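(* Fix $\lambda\in(0,1)$ and $\mu\in(0,1)$. Let $\{L(t)\}$ be the infinite-buffer reference chain and, for each integer $B\ge1$, let $\{L^B(t)\}$ be its truncation at level $B$ (both defined in the context). Let $\pi$ and $\pi^B$ denote their stationary distributions, and set $C^\infty:=1-\pi_0$ and $C^B:=1-\pi^B_0$. Then there exist constants $\theta>0$ and $M<\infty$, depending on $(\lambda,\mu)$ but not on $B$, such that $$0\le C^\infty-C^B\le M e^{-\theta B}\qquad\text{for all integers }B\ge1.$$ In particular, $C^B\uparrow C^\infty$ as $B\to\infty$, and the convergence is exponentially fast in $B$.
   Context: Reference chain with buffer size $B\in\{1,2,\dots\}\cup\{\infty\}$ and parameters $\lambda,\mu$: it is a Markov chain with state space $\{0,1,\dots,B\}$ (or $\mathbb Z_{\ge0}$ if $B=\infty$). From state $i$, one time step proceeds as follows: draw independent $S\sim\mathrm{Bernoulli}(\lambda)$ (service attempt) and $A\sim\mathrm{Bernoulli}(\lambda)$ (arrival); set $K_{\mathrm{serv}}=\max(0,i-S)$; conditionally on $K_{\mathrm{serv}}$ and independently of $A$, draw $K_{\mathrm{dec}}\sim\mathrm{Binom}(K_{\mathrm{serv}},1-\mu)$ (survivors of decoherence); the next state is $\min(B,K_{\mathrm{dec}}+A)$, which is simply $K_{\mathrm{dec}}+A$ when $B=\infty$. All draws are independent across time steps. The "truncation at level $B$" is the chain with buffer size $B$. The subscript $0$ in $\pi_0,\pi^B_0$ denotes the stationary mass at state $0$. *)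

theory Defs
  imports "HOL-Probability.Probability" "HOL-Library.Extended_Nat"
begin

definition buffer_states :: "enat \<Rightarrow> nat set" where
  "buffer_states B = {i. enat i \<le> B}"

definition buffer_cap :: "enat \<Rightarrow> nat \<Rightarrow> nat" where
  "buffer_cap B n = (case B of enat b \<Rightarrow> min b n | \<infinity> \<Rightarrow> n)"

(* One-step transition law from state i. Service attempt and arrival have the same
   parameter lam; natural-number subtraction gives max 0 (i - S). *)
definition ref_step :: "real \<Rightarrow> real \<Rightarrow> enat \<Rightarrow> nat \<Rightarrow> nat pmf" where
  "ref_step lam mu B i =
     do {
       S \<leftarrow> bernoulli_pmf lam;
       A \<leftarrow> bernoulli_pmf lam;
       K_dec \<leftarrow> binomial_pmf (i - of_bool S) (1 - mu);
       return_pmf (buffer_cap B (K_dec + of_bool A))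
     }"

definition is_stationary :: "real \<Rightarrow> real \<Rightarrow> enat \<Rightarrow> nat pmf \<Rightarrow> bool" where
  "is_stationary lam mu B p \<longleftrightarrow>
     set_pmf p \<subseteq> buffer_states B \<and> bind_pmf p (ref_step lam mu B) = p"

definition stationary_dist :: "real \<Rightarrow> real \<Rightarrow> enat \<Rightarrow> nat pmf" where
  "stationary_dist lam mu B = (THE p. is_stationary lam mu B p)"

(* The quantity written C: the stationary probability of not being in state 0. *)
definition ref_C :: "real \<Rightarrow> real \<Rightarrow> enat \<Rightarrow> real" where
  "ref_C lam mu B = 1 - pmf (stationary_dist lam mu B) 0"

end

theory Submission imports Defs begin

text \<open>Everything rests on one contraction. Two copies of the chain in adjacent states can share
  service attempt, arrival and decoherence; the extra item survives a step with probability at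
  most \<open>1 - mu\<close>. Hence, for every buffer size, one step of the transition operator shrinks the
  increments \<open>\<bar>f (k + 1) - f k\<bar>\<close> of a function by the factor \<open>1 - mu\<close> (\<open>ref_step_contracts\<close>).

  A function with values in \<open>[0, 1]\<close> has increments at most 1. So the laws after \<open>n\<close> steps from the
  empty state are Cauchy in total variation, and their limit is stationary
  (\<open>uniform_Cauchy_pmf_limit\<close>, \<open>stationary_exists\<close>). The initial state is forgotten, so every
  stationary law is this limit (\<open>stationary_pmf_limit\<close>). Consequently \<open>ref_C\<close> is the limit of the
  \<open>n\<close>-step probabilities of being nonempty.

  The step preserves monotone functions and is monotone in the buffer size, so \<open>ref_C\<close> increases
  with the buffer size. For the rate, expand the difference of the \<open>n\<close>-step expectations of the two
  chains into one-step differences. Capping at \<open>B\<close> matters only when the buffer is full and nothing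
  is lost, an event of probability at most \<open>(1 - mu) ^ B\<close>, and the effect of an overflow with \<open>j\<close>
  steps left is at most \<open>(1 - mu) ^ j\<close>. Summing over \<open>j\<close> gives the bound \<open>(1 - mu) ^ B / mu\<close>
  (\<open>ref_C_truncation\<close>), that is, \<open>\<theta> = - ln (1 - mu)\<close> and \<open>M = 1 / mu\<close>.\<close>

section \<open>Expectations of probability mass functions\<close>

lemma integrable_measure_pmf_unit:
  fixes f :: "'a \<Rightarrow> real"
  assumes "\<And>k. 0 \<le> f k" "\<And>k. f k \<le> 1"
  shows "integrable (measure_pmf p) f"
  using assms by (intro measure_pmf.integrable_const_bound[where B = 1]) auto

lemma expectation_bind_pmf_finite:
  fixes h :: "'b \<Rightarrow> real"
  assumes "finite (set_pmf p)" "\<And>x. x \<in> set_pmf p \<Longrightarrow> finite (set_pmf (f x))"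
  shows "measure_pmf.expectation (bind_pmf p f) h =
         measure_pmf.expectation p (\<lambda>x. measure_pmf.expectation (f x) h)"
  using pmf_expectation_bind[of "set_pmf p" f p h] assms
  by (simp add: integral_measure_pmf[of "set_pmf p"])

lemma abs_expectation_le:
  fixes f :: "'a \<Rightarrow> real"
  assumes "finite (set_pmf p)" "\<And>x. x \<in> set_pmf p \<Longrightarrow> \<bar>f x\<bar> \<le> c"
  shows "\<bar>measure_pmf.expectation p f\<bar> \<le> c"
proof -
  have int: "integrable (measure_pmf p) g" for g :: "'a \<Rightarrow> real"
    using assms(1) by (rule integrable_measure_pmf_finite)
  have "\<bar>measure_pmf.expectation p f\<bar> \<le> measure_pmf.expectation p (\<lambda>x. \<bar>f x\<bar>)"
    by (rule integral_abs_bound)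
  also have "\<dots> \<le> measure_pmf.expectation p (\<lambda>_. c)"
    using assms(2) by (intro integral_mono_AE int) (auto simp: AE_measure_pmf_iff)
  finally show ?thesis
    by simp
qed

text \<open>Completeness in total variation: if the expectations of all \<open>[0, 1]\<close>-valued functions under
  finitely supported laws \<open>D n\<close> are Cauchy at a uniform rate, the laws converge. No mass escapes,
  since the limit puts at least \<open>1 - e n\<close> on the finite support of \<open>D n\<close>.\<close>

lemma uniform_Cauchy_pmf_limit:
  fixes D :: "nat \<Rightarrow> nat pmf" and e :: "nat \<Rightarrow> real"
  assumes fin: "\<And>n. finite (set_pmf (D n))"
    and cauchy: "\<And>f m n. (\<And>k. 0 \<le> f k) \<Longrightarrow> (\<And>k. f k \<le> 1) \<Longrightarrow> n \<le> m \<Longrightarrow>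
      \<bar>measure_pmf.expectation (D m) f - measure_pmf.expectation (D n) f\<bar> \<le> e n"
    and e: "e \<longlonglongrightarrow> 0"
  obtains p :: "nat pmf" where
    "\<And>f. (\<And>k. 0 \<le> f k) \<Longrightarrow> (\<And>k. f k \<le> (1::real)) \<Longrightarrow>
      (\<lambda>n. measure_pmf.expectation (D n) f) \<longlonglongrightarrow> measure_pmf.expectation p f"
proof -
  define E where "E n f = measure_pmf.expectation (D n) f" for n and f :: "nat \<Rightarrow> real"
  define l where "l f = lim (\<lambda>n. E n f)" for f
  define U where "U = {f :: nat \<Rightarrow> real. \<forall>k. 0 \<le> f k \<and> f k \<le> 1}"
  have E_Cauchy: "\<bar>E m f - E n f\<bar> \<le> e n" if "f \<in> U" "n \<le> m" for f m n
    unfolding E_def using that by (intro cauchy) (auto simp: U_def)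
  have l: "(\<lambda>n. E n f) \<longlonglongrightarrow> l f" if f: "f \<in> U" for f
  proof -
    have "Cauchy (\<lambda>n. E n f)"
    proof (rule metric_CauchyI)
      fix r :: real assume "r > 0"
      then obtain N where N: "\<bar>e N\<bar> < r / 2"
        using LIMSEQ_D[OF e, of "r / 2"] by auto
      have "dist (E m f) (E n f) < r" if "m \<ge> N" "n \<ge> N" for m n
        using E_Cauchy[OF f that(1)] E_Cauchy[OF f that(2)] N
        unfolding dist_real_def by linarith
      then show "\<exists>M. \<forall>m\<ge>M. \<forall>n\<ge>M. dist (E m f) (E n f) < r"
        by blast
    qed
    then show ?thesis
      unfolding l_def by (simp add: Cauchy_convergent convergent_LIMSEQ_iff[symmetric])
  qed
  have l_dist: "\<bar>l f - E n f\<bar> \<le> e n" if "f \<in> U" for f n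
  proof (rule Lim_bounded)
    show "(\<lambda>m. \<bar>E m f - E n f\<bar>) \<longlonglongrightarrow> \<bar>l f - E n f\<bar>"
      by (intro tendsto_intros l that)
    show "\<forall>m\<ge>n. \<bar>E m f - E n f\<bar> \<le> e n"
      using E_Cauchy that by blast
  qed
  have E_ge0: "0 \<le> E n f" if "f \<in> U" for n f
    unfolding E_def using that by (intro integral_nonneg_AE) (auto simp: U_def)
  have E_le1: "E n f \<le> 1" if "f \<in> U" for n f
    unfolding E_def using that
    by (intro measure_pmf.integral_le_const integrable_measure_pmf_finite fin) (auto simp: U_def)
  have l_ge0: "0 \<le> l f" if "f \<in> U" for f
    using l[OF that] E_ge0[OF that] by (intro LIMSEQ_le_const) auto
  have l_le1: "l f \<le> 1" if "f \<in> U" for f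
    using l[OF that] E_le1[OF that] by (intro LIMSEQ_le_const2) auto
  define P where "P k = l (indicator {k})" for k
  have ind_U: "indicator A \<in> U" for A :: "nat set"
    by (auto simp: U_def indicator_def)
  have P_ge0: "0 \<le> P k" for k
    unfolding P_def by (intro l_ge0 ind_U)
  have restr_U: "(\<lambda>k. f k * indicator {..<N} k) \<in> U" if "f \<in> U" for f N
    using that by (auto simp: U_def indicator_def)
  have E_restr: "E n (\<lambda>k. f k * indicator {..<N} k) = (\<Sum>k<N. f k * E n (indicator {k}))" for n f N
  proof -
    have "E n (\<lambda>k. f k * indicator {..<N} k) = (\<Sum>k<N. (f k * indicator {..<N} k) * pmf (D n) k)"
      unfolding E_def by (rule integral_measure_pmf_real) (auto simp: indicator_def split: if_splits)
    also have "\<dots> = (\<Sum>k<N. f k * E n (indicator {k}))"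
      by (intro sum.cong) (auto simp: E_def pmf.rep_eq)
    finally show ?thesis .
  qed
  have l_restr: "l (\<lambda>k. f k * indicator {..<N} k) = (\<Sum>k<N. f k * P k)" if "f \<in> U" for f N
  proof (rule LIMSEQ_unique)
    show "(\<lambda>n. E n (\<lambda>k. f k * indicator {..<N} k)) \<longlonglongrightarrow> l (\<lambda>k. f k * indicator {..<N} k)"
      by (intro l restr_U that)
    show "(\<lambda>n. E n (\<lambda>k. f k * indicator {..<N} k)) \<longlonglongrightarrow> (\<Sum>k<N. f k * P k)"
      unfolding E_restr P_def by (intro tendsto_intros l ind_U)
  qed
  have one_U: "(\<lambda>_. 1) \<in> U"
    by (auto simp: U_def)
  have lower: "\<exists>N. E n f - e n \<le> (\<Sum>k<N. f k * P k)" if f: "f \<in> U" for f n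
  proof -
    obtain N where N: "set_pmf (D n) \<subseteq> {..<N}"
      using fin[of n] finite_nat_bounded by blast
    have "E n f = E n (\<lambda>k. f k * indicator {..<N} k)"
      unfolding E_def using N by (intro integral_cong_AE) (auto simp: AE_measure_pmf_iff subset_eq)
    then show ?thesis
      using l_dist[OF restr_U[OF f, of N], of n] l_restr[OF f, of N] by (intro exI[of _ N]) linarith
  qed
  have P_part: "(\<Sum>k<N. P k) \<le> 1" for N
    using l_restr[OF one_U, of N] l_le1[OF restr_U[OF one_U, of N]] by simp
  have summ: "summable P"
    using P_ge0 P_part by (intro summableI_nonneg_bounded)
  have "(\<Sum>k. P k) = 1"
  proof (rule antisym)
    show "(\<Sum>k. P k) \<le> 1"
      using P_part by (intro suminf_le_const summ)
    have "1 - e n \<le> (\<Sum>k. P k)" for n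
    proof -
      obtain N where "E n (\<lambda>_. 1) - e n \<le> (\<Sum>k<N. 1 * P k)"
        using lower[OF one_U] by blast
      also have "\<dots> \<le> (\<Sum>k. P k)"
        using P_ge0 by (auto intro!: sum_le_suminf summ)
      finally show ?thesis
        by (simp add: E_def)
    qed
    moreover have "(\<lambda>n. 1 - e n) \<longlonglongrightarrow> 1 - 0"
      by (intro tendsto_intros e)
    ultimately show "1 \<le> (\<Sum>k. P k)"
      by (intro LIMSEQ_le_const2[where X = "\<lambda>n. 1 - e n"]) auto
  qed
  with summ have "P sums 1"
    by (simp add: sums_iff)
  then have prob: "(\<integral>\<^sup>+k. P k \<partial>count_space UNIV) = 1"
    using suminf_ennreal_eq[OF P_ge0] by (simp add: nn_integral_count_space_nat)
  define p where "p = embed_pmf P"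
  have pmf_p: "pmf p k = P k" for k
    unfolding p_def by (rule pmf_embed_pmf[OF P_ge0 prob])
  have below: "E n f - e n \<le> measure_pmf.expectation p f" if f: "f \<in> U" for f n
  proof -
    obtain N where "E n f - e n \<le> (\<Sum>k<N. f k * P k)"
      using lower[OF f] by blast
    also have "\<dots> = (\<Sum>k<N. (f k * indicator {..<N} k) * pmf p k)"
      by (intro sum.cong) (auto simp: pmf_p)
    also have "\<dots> = measure_pmf.expectation p (\<lambda>k. f k * indicator {..<N} k)"
      by (rule integral_measure_pmf_real[symmetric]) (auto simp: indicator_def split: if_splits)
    also have "\<dots> \<le> measure_pmf.expectation p f"
      using f restr_U[OF f, of N]
      by (intro integral_mono integrable_measure_pmf_unit) (auto simp: U_def indicator_def)
    finally show ?thesis .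
  qed
  have close: "\<bar>E n f - measure_pmf.expectation p f\<bar> \<le> e n" if f: "f \<in> U" for f n
  proof -
    have "(\<lambda>k. 1 - f k) \<in> U"
      using f by (auto simp: U_def)
    \<comment> \<open>The lower bound for \<open>1 - f\<close> is the upper bound for \<open>f\<close>.\<close>
    from below[OF this, of n] have "1 - E n f - e n \<le> 1 - measure_pmf.expectation p f"
      using f unfolding E_def
      by (subst (asm) (1 2) Bochner_Integration.integral_diff)
         (auto simp: U_def intro!: integrable_measure_pmf_unit)
    with below[OF f, of n] show ?thesis
      by linarith
  qed
  show thesis
  proof (rule that)
    fix f :: "nat \<Rightarrow> real"
    assume "\<And>k. 0 \<le> f k" "\<And>k. f k \<le> 1"
    then have "f \<in> U"
      by (auto simp: U_def)
    have "(\<lambda>n. E n f - measure_pmf.expectation p f) \<longlonglongrightarrow> 0"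
      by (rule Lim_null_comparison[OF _ e]) (use close[OF \<open>f \<in> U\<close>] in auto)
    then show "(\<lambda>n. measure_pmf.expectation (D n) f) \<longlonglongrightarrow> measure_pmf.expectation p f"
      unfolding E_def by (simp add: LIM_zero_iff)
  qed
qed


section \<open>Binomial thinning\<close>

lemma expectation_binomial_Suc:
  fixes g :: "nat \<Rightarrow> real"
  assumes "0 \<le> q" "q \<le> 1"
  shows "measure_pmf.expectation (binomial_pmf (Suc m) q) g =
         measure_pmf.expectation (binomial_pmf m q) (\<lambda>k. q * g (Suc k) + (1 - q) * g k)"
proof -
  have fin: "finite (set_pmf (binomial_pmf m q))"
    using assms by (intro finite_set_pmf_binomial_pmf) auto
  note int = integrable_measure_pmf_finite[OF fin]
  have *: "measure_pmf.expectation (bind_pmf (binomial_pmf m q) (\<lambda>k. return_pmf (j + k))) g =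
      measure_pmf.expectation (binomial_pmf m q) (\<lambda>k. g (j + k))" for j
    using fin by (subst expectation_bind_pmf_finite) auto
  show ?thesis
    using assms fin
    by (simp add: binomial_pmf_Suc expectation_bind_pmf_finite * int mult.commute)
qed

text \<open>Thinning contracts increments: an extra item survives with probability \<open>q\<close> only.\<close>

lemma thinning_contracts:
  fixes g :: "nat \<Rightarrow> real"
  assumes "0 \<le> q" "q \<le> 1" "\<And>k. \<bar>g (Suc k) - g k\<bar> \<le> L"
  shows "\<bar>measure_pmf.expectation (binomial_pmf (Suc m) q) g -
          measure_pmf.expectation (binomial_pmf m q) g\<bar> \<le> q * L"
proof -
  have fin: "finite (set_pmf (binomial_pmf m q))"
    using assms by (intro finite_set_pmf_binomial_pmf) auto
  note int = integrable_measure_pmf_finite[OF fin]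
  have "measure_pmf.expectation (binomial_pmf (Suc m) q) g -
          measure_pmf.expectation (binomial_pmf m q) g =
        measure_pmf.expectation (binomial_pmf m q) (\<lambda>k. q * (g (Suc k) - g k))"
    unfolding expectation_binomial_Suc[OF assms(1,2)]
    by (subst Bochner_Integration.integral_diff[symmetric])
       (auto simp: int algebra_simps)
  also have "\<bar>\<dots>\<bar> \<le> q * L"
    using assms by (intro abs_expectation_le fin) (auto simp: abs_mult mult_left_mono)
  finally show ?thesis .
qed

lemma thinning_mono:
  fixes g :: "nat \<Rightarrow> real"
  assumes "0 \<le> q" "q \<le> 1" "mono g"
  shows "mono (\<lambda>m. measure_pmf.expectation (binomial_pmf m q) g)"
proof (rule mono_iff_le_Suc[THEN iffD2], rule allI)
  fix m
  have fin: "finite (set_pmf (binomial_pmf m q))"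
    using assms by (intro finite_set_pmf_binomial_pmf) auto
  note int = integrable_measure_pmf_finite[OF fin]
  have "g k \<le> q * g (Suc k) + (1 - q) * g k" for k
    using mult_left_mono[of "g k" "g (Suc k)" q] assms by (simp add: algebra_simps monoD)
  then show "measure_pmf.expectation (binomial_pmf m q) g \<le>
      measure_pmf.expectation (binomial_pmf (Suc m) q) g"
    unfolding expectation_binomial_Suc[OF assms(1,2)] by (intro integral_mono int)
qed


section \<open>One step of the chain\<close>

lemma buffer_cap_Suc:
  "buffer_cap B (Suc k) = buffer_cap B k \<or> buffer_cap B (Suc k) = Suc (buffer_cap B k)"
  by (auto simp: buffer_cap_def min_def split: enat.split)

lemma mono_buffer_cap: "mono (buffer_cap B)"
  by (auto simp: buffer_cap_def mono_def split: enat.split)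

lemma buffer_cap_mono_level: "B \<le> B' \<Longrightarrow> buffer_cap B k \<le> buffer_cap B' k"
  by (cases B; cases B') (auto simp: buffer_cap_def)

text \<open>The function \<open>f\<close> of the next state, averaged over the arrival, when \<open>k\<close> items have
  survived decoherence.\<close>

definition arrival_avg :: "real \<Rightarrow> enat \<Rightarrow> (nat \<Rightarrow> real) \<Rightarrow> nat \<Rightarrow> real" where
  "arrival_avg lam B f k = lam * f (buffer_cap B (Suc k)) + (1 - lam) * f (buffer_cap B k)"

lemma convex_abs_le:
  fixes a b c t :: real
  assumes "0 \<le> t" "t \<le> 1" "\<bar>a\<bar> \<le> c" "\<bar>b\<bar> \<le> c"
  shows "\<bar>t * a + (1 - t) * b\<bar> \<le> c"
proof -
  have "\<bar>t * a + (1 - t) * b\<bar> \<le> t * \<bar>a\<bar> + (1 - t) * \<bar>b\<bar>"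
    using assms by (intro order.trans[OF abs_triangle_ineq]) (simp add: abs_mult)
  also have "\<dots> \<le> c"
    using assms by (intro convex_bound_le) auto
  finally show ?thesis .
qed

locale reference_chain =
  fixes lam mu :: real
  assumes lam: "0 < lam" "lam < 1" and mu: "0 < mu" "mu < 1"
begin

lemma finite_ref_step: "finite (set_pmf (ref_step lam mu B i))"
  unfolding ref_step_def using mu by (auto simp: set_bind_pmf)

lemma integrable_ref_step: "integrable (measure_pmf (ref_step lam mu B i)) (f :: nat \<Rightarrow> real)"
  by (rule integrable_measure_pmf_finite[OF finite_ref_step])

lemma set_pmf_ref_step: "set_pmf (ref_step lam mu B i) \<subseteq> buffer_states B"
  unfolding ref_step_def
  by (auto simp: set_bind_pmf buffer_cap_def buffer_states_def split: enat.splits)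

lemma integrable_binomial: "integrable (measure_pmf (binomial_pmf m (1 - mu))) (f :: nat \<Rightarrow> real)"
  using mu by (intro integrable_measure_pmf_finite finite_set_pmf_binomial_pmf) auto

lemma expectation_ref_step:
  "measure_pmf.expectation (ref_step lam mu B i) f =
     lam * measure_pmf.expectation (binomial_pmf (i - 1) (1 - mu)) (arrival_avg lam B f) +
     (1 - lam) * measure_pmf.expectation (binomial_pmf i (1 - mu)) (arrival_avg lam B f)"
proof -
  define G where "G m g = measure_pmf.expectation (binomial_pmf m (1 - mu)) g" for m and g :: "nat \<Rightarrow> real"
  have "measure_pmf.expectation (ref_step lam mu B i) f =
     lam * (lam * G (i - 1) (\<lambda>k. f (buffer_cap B (Suc k))) + (1 - lam) * G (i - 1) (\<lambda>k. f (buffer_cap B k))) +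
     (1 - lam) * (lam * G i (\<lambda>k. f (buffer_cap B (Suc k))) + (1 - lam) * G i (\<lambda>k. f (buffer_cap B k)))"
    unfolding ref_step_def G_def using lam mu
    by (simp add: expectation_bind_pmf_finite set_bind_pmf mult.commute)
  then show ?thesis
    unfolding arrival_avg_def G_def by (simp add: integrable_binomial)
qed

text \<open>The step contracts increments, whatever the buffer size: adding one item to the state changes
  the number of items that face decoherence by at most one, and the cap is nonexpansive.\<close>

lemma ref_step_contracts:
  fixes f :: "nat \<Rightarrow> real"
  assumes f: "\<And>k. \<bar>f (Suc k) - f k\<bar> \<le> L"
  shows "\<bar>measure_pmf.expectation (ref_step lam mu B (Suc i)) f -
          measure_pmf.expectation (ref_step lam mu B i) f\<bar> \<le> (1 - mu) * L"
proof -
  define G where "G m = measure_pmf.expectation (binomial_pmf m (1 - mu)) (arrival_avg lam B f)" for m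
  have L: "0 \<le> L"
    using f[of 0] by linarith
  have cap: "\<bar>f (buffer_cap B (Suc k)) - f (buffer_cap B k)\<bar> \<le> L" for k
    using buffer_cap_Suc[of B k] f[of "buffer_cap B k"] L by auto
  have "\<bar>arrival_avg lam B f (Suc k) - arrival_avg lam B f k\<bar> \<le> L" for k
    using convex_abs_le[OF _ _ cap[of "Suc k"] cap[of k], of lam] lam
    by (simp add: arrival_avg_def algebra_simps)
  then have G: "\<bar>G (Suc m) - G m\<bar> \<le> (1 - mu) * L" for m
    unfolding G_def using mu by (intro thinning_contracts) auto
  have G': "\<bar>G i - G (i - 1)\<bar> \<le> (1 - mu) * L"
    using G[of "i - 1"] L mu by (cases i) auto
  show ?thesis
    using convex_abs_le[OF _ _ G' G[of i], of lam] lam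
    by (simp add: expectation_ref_step G_def[symmetric] algebra_simps)
qed

lemma ref_step_mono:
  fixes f :: "nat \<Rightarrow> real"
  assumes "mono f"
  shows "mono (\<lambda>i. measure_pmf.expectation (ref_step lam mu B i) f)"
proof -
  have "arrival_avg lam B f k \<le> arrival_avg lam B f (Suc k)" for k
    unfolding arrival_avg_def using lam assms mono_buffer_cap[of B]
    by (intro add_mono mult_left_mono) (auto simp: mono_def)
  then have "mono (arrival_avg lam B f)"
    by (simp add: mono_iff_le_Suc)
  then have "mono (\<lambda>m. measure_pmf.expectation (binomial_pmf m (1 - mu)) (arrival_avg lam B f))"
    using mu by (intro thinning_mono) auto
  then show ?thesis
    unfolding expectation_ref_step using lam
    by (intro monoI add_mono mult_left_mono) (auto simp: mono_def diff_le_mono)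
qed

lemma ref_step_mono_level:
  fixes f :: "nat \<Rightarrow> real"
  assumes "mono f" "B \<le> B'"
  shows "measure_pmf.expectation (ref_step lam mu B i) f \<le>
         measure_pmf.expectation (ref_step lam mu B' i) f"
proof -
  have "arrival_avg lam B f k \<le> arrival_avg lam B' f k" for k
    unfolding arrival_avg_def using lam assms buffer_cap_mono_level[of B B']
    by (intro add_mono mult_left_mono) (auto simp: mono_def)
  then show ?thesis
    unfolding expectation_ref_step using lam
    by (intro add_mono mult_left_mono integral_mono integrable_binomial) auto
qed

text \<open>Capping at \<open>B\<close> alters the step from a state \<open>i \<le> B\<close> only if all of \<open>B\<close> items survive
  decoherence, which has probability at most \<open>(1 - mu) ^ B\<close>.\<close>

lemma ref_step_truncation:
  fixes B :: nat and f :: "nat \<Rightarrow> real"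
  assumes f: "\<And>k. \<bar>f (Suc k) - f k\<bar> \<le> L" and "i \<le> B"
  shows "\<bar>measure_pmf.expectation (ref_step lam mu \<infinity> i) f -
          measure_pmf.expectation (ref_step lam mu (enat B) i) f\<bar> \<le> (1 - mu) ^ B * L"
proof -
  define G where "G C m = measure_pmf.expectation (binomial_pmf m (1 - mu)) (arrival_avg lam C f)" for C m
  have L: "0 \<le> L"
    using f[of 0] by linarith
  have G: "\<bar>G \<infinity> m - G (enat B) m\<bar> \<le> (1 - mu) ^ B * L" if "m \<le> B" for m
  proof -
    have "G \<infinity> m - G (enat B) m = measure_pmf.expectation (binomial_pmf m (1 - mu))
        (\<lambda>k. arrival_avg lam \<infinity> f k - arrival_avg lam (enat B) f k)"
      by (simp add: G_def integrable_binomial)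
    also have "\<dots> = (\<Sum>k\<in>{B}. (arrival_avg lam \<infinity> f k - arrival_avg lam (enat B) f k)
        * pmf (binomial_pmf m (1 - mu)) k)"
      using mu that
      by (intro integral_measure_pmf_real)
         (auto simp: arrival_avg_def buffer_cap_def min_def le_Suc_eq split: if_splits)
    also have "\<dots> = lam * (f (Suc B) - f B) * pmf (binomial_pmf m (1 - mu)) B"
      by (simp add: arrival_avg_def buffer_cap_def algebra_simps)
    also have "\<bar>\<dots>\<bar> \<le> L * (1 - mu) ^ B"
    proof -
      have "\<bar>lam * (f (Suc B) - f B)\<bar> \<le> 1 * L"
        unfolding abs_mult using f[of B] lam by (intro mult_mono) auto
      moreover have "\<bar>pmf (binomial_pmf m (1 - mu)) B\<bar> \<le> (1 - mu) ^ B"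
        using that mu by (cases "m = B") (auto simp: binomial_eq_0)
      ultimately show ?thesis
        unfolding abs_mult[of _ "pmf _ _"] using L by (intro mult_mono) auto
    qed
    finally show ?thesis
      by (simp add: mult.commute)
  qed
  show ?thesis
    using convex_abs_le[OF _ _ G[of "i - 1"] G[of i], of lam] lam \<open>i \<le> B\<close>
    by (simp add: expectation_ref_step G_def[symmetric] algebra_simps)
qed


section \<open>The law after several steps\<close>

text \<open>\<open>ref_steps B n i\<close> is the law of the state after \<open>n\<close> steps from state \<open>i\<close>.\<close>

primrec ref_steps :: "enat \<Rightarrow> nat \<Rightarrow> nat \<Rightarrow> nat pmf" where
  "ref_steps B 0 i = return_pmf i"
| "ref_steps B (Suc n) i = bind_pmf (ref_step lam mu B i) (ref_steps B n)"

lemma ref_steps_Suc':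
  "ref_steps B (Suc n) i = bind_pmf (ref_steps B n i) (ref_step lam mu B)"
proof (induction n arbitrary: i)
  case 0
  then show ?case
    by (simp add: bind_return_pmf bind_return_pmf' cong: bind_pmf_cong)
next
  case (Suc n)
  have "ref_steps B (Suc (Suc n)) i =
      bind_pmf (ref_step lam mu B i) (\<lambda>j. bind_pmf (ref_steps B n j) (ref_step lam mu B))"
    unfolding ref_steps.simps(2)[of B "Suc n"] Suc.IH ..
  then show ?case
    by (simp add: bind_assoc_pmf)
qed

lemma finite_ref_steps: "finite (set_pmf (ref_steps B n i))"
  by (induction n arbitrary: i) (auto simp: set_bind_pmf finite_ref_step)

text \<open>The \<open>n\<close>-step transition operator applied to \<open>f\<close>, evaluated at the initial state \<open>i\<close>.\<close>

abbreviation expect :: "enat \<Rightarrow> nat \<Rightarrow> (nat \<Rightarrow> real) \<Rightarrow> nat \<Rightarrow> real" where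
  "expect B n f i \<equiv> measure_pmf.expectation (ref_steps B n i) f"

lemma expect_Suc:
  "expect B (Suc n) f i = measure_pmf.expectation (ref_step lam mu B i) (expect B n f)"
  by (simp add: expectation_bind_pmf_finite finite_ref_step finite_ref_steps)

lemma expect_contracts:
  fixes f :: "nat \<Rightarrow> real"
  assumes "\<And>k. \<bar>f (Suc k) - f k\<bar> \<le> L"
  shows "\<bar>expect B n f (Suc i) - expect B n f i\<bar> \<le> (1 - mu) ^ n * L"
proof (induction n arbitrary: i)
  case (Suc n)
  show ?case
    unfolding expect_Suc using ref_step_contracts[where f = "expect B n f", OF Suc.IH] by (simp add: mult.assoc)
qed (use assms in simp)

lemma expect_mono:
  fixes f :: "nat \<Rightarrow> real"
  assumes "mono f"
  shows "mono (expect B n f)"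
proof (induction n)
  case 0
  then show ?case
    using assms by (simp add: mono_def)
next
  case (Suc n)
  then show ?case
    unfolding expect_Suc by (rule ref_step_mono)
qed

lemma expect_mono_level:
  fixes f :: "nat \<Rightarrow> real"
  assumes "mono f" "B \<le> B'"
  shows "expect B n f i \<le> expect B' n f i"
proof (induction n arbitrary: i)
  case (Suc n)
  have "expect B (Suc n) f i \<le> measure_pmf.expectation (ref_step lam mu B i) (expect B' n f)"
    unfolding expect_Suc by (intro integral_mono integrable_ref_step Suc.IH)
  also have "\<dots> \<le> expect B' (Suc n) f i"
    unfolding expect_Suc by (intro ref_step_mono_level expect_mono assms)
  finally show ?case .
qed simp

lemma expect_initial_state:
  fixes f :: "nat \<Rightarrow> real"
  assumes "\<And>k. \<bar>f (Suc k) - f k\<bar> \<le> L"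
  shows "\<bar>expect B n f i - expect B n f 0\<bar> \<le> real i * ((1 - mu) ^ n * L)"
proof (induction i)
  case (Suc i)
  then show ?case
    using expect_contracts[where f = f and B = B and n = n and i = i, OF assms] by (simp add: algebra_simps)
qed simp

lemma geometric_partial_le:
  assumes "0 \<le> c"
  shows "c * (\<Sum>j<n. (1 - mu) ^ j) \<le> c / mu"
proof -
  have "(\<Sum>j<n. (1 - mu) ^ j) = (1 - (1 - mu) ^ n) / mu"
    using mu by (simp add: sum_gp_strict)
  also have "\<dots> \<le> 1 / mu"
    using mu by (intro divide_right_mono) auto
  finally show ?thesis
    using mult_left_mono[OF _ assms] by fastforce
qed

text \<open>From the empty state one step reaches at most state 1, so one further step moves an
  expectation by at most one contracted increment.\<close>

lemma expect_Cauchy: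
  fixes f :: "nat \<Rightarrow> real"
  assumes f: "\<And>k. \<bar>f (Suc k) - f k\<bar> \<le> L" and "n \<le> m"
  shows "\<bar>expect B m f 0 - expect B n f 0\<bar> \<le> (1 - mu) ^ n * L / mu"
proof -
  have L: "0 \<le> L"
    using f[of 0] by linarith
  have step: "\<bar>expect B (Suc n) f 0 - expect B n f 0\<bar> \<le> (1 - mu) ^ n * L" for n
  proof -
    have "buffer_cap B 0 = 0"
      by (simp add: buffer_cap_def split: enat.split)
    then have "expect B (Suc n) f 0 - expect B n f 0 =
        lam * (expect B n f (buffer_cap B (Suc 0)) - expect B n f 0) + (1 - lam) * 0"
      unfolding expect_Suc expectation_ref_step using mu
      by (simp add: arrival_avg_def algebra_simps expectation_binomial_pmf')
    also have "\<bar>\<dots>\<bar> \<le> (1 - mu) ^ n * L"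
    proof (rule convex_abs_le)
      show "\<bar>expect B n f (buffer_cap B (Suc 0)) - expect B n f 0\<bar> \<le> (1 - mu) ^ n * L"
        using buffer_cap_Suc[of B 0] \<open>buffer_cap B 0 = 0\<close> L mu
          expect_contracts[where f = f and B = B and n = n and i = 0, OF f] by auto
    qed (use lam L mu in auto)
    finally show ?thesis .
  qed
  have "\<bar>expect B (n + d) f 0 - expect B n f 0\<bar> \<le> (1 - mu) ^ n * L * (\<Sum>j<d. (1 - mu) ^ j)" for d
  proof (induction d)
    case (Suc d)
    then show ?case
      using step[of "n + d"] unfolding add_Suc_right
      by (simp add: power_add algebra_simps del: ref_steps.simps(2))
  qed simp
  from this[of "m - n"] \<open>n \<le> m\<close> geometric_partial_le[of "(1 - mu) ^ n * L" "m - n"] L mu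
  show ?thesis
    by simp
qed

text \<open>Each step contributes an overflow error of at most \<open>(1 - mu) ^ B\<close> times the increments
  remaining at that time, which form a geometric series.\<close>

lemma expect_truncation:
  fixes B :: nat and f :: "nat \<Rightarrow> real"
  assumes f: "\<And>k. \<bar>f (Suc k) - f k\<bar> \<le> L" and "i \<le> B"
  shows "\<bar>expect \<infinity> n f i - expect (enat B) n f i\<bar> \<le> (1 - mu) ^ B * L / mu"
proof -
  have L: "0 \<le> L"
    using f[of 0] by linarith
  have "\<bar>expect \<infinity> n f i - expect (enat B) n f i\<bar> \<le> (1 - mu) ^ B * L * (\<Sum>j<n. (1 - mu) ^ j)"
    using \<open>i \<le> B\<close>
  proof (induction n arbitrary: i)
    case (Suc n)
    let ?E = "measure_pmf.expectation (ref_step lam mu (enat B) i)"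
    have "\<bar>expect \<infinity> (Suc n) f i - ?E (expect \<infinity> n f)\<bar> \<le> (1 - mu) ^ B * ((1 - mu) ^ n * L)"
      unfolding expect_Suc by (intro ref_step_truncation expect_contracts f Suc.prems)
    moreover have "\<bar>?E (expect \<infinity> n f) - expect (enat B) (Suc n) f i\<bar> \<le>
        (1 - mu) ^ B * L * (\<Sum>j<n. (1 - mu) ^ j)"
    proof -
      have "?E (expect \<infinity> n f) - expect (enat B) (Suc n) f i =
          ?E (\<lambda>k. expect \<infinity> n f k - expect (enat B) n f k)"
        unfolding expect_Suc by (simp add: integrable_ref_step)
      also have "\<bar>\<dots>\<bar> \<le> (1 - mu) ^ B * L * (\<Sum>j<n. (1 - mu) ^ j)"
        using set_pmf_ref_step[of "enat B" i]
        by (intro abs_expectation_le finite_ref_step Suc.IH) (auto simp: buffer_states_def)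
      finally show ?thesis .
    qed
    ultimately show ?case
      by (simp add: algebra_simps del: ref_steps.simps(2))
  qed simp
  also have "\<dots> \<le> (1 - mu) ^ B * L / mu"
    using L mu by (intro geometric_partial_le) auto
  finally show ?thesis .
qed


section \<open>The stationary law\<close>

lemma unit_increments:
  fixes f :: "nat \<Rightarrow> real"
  assumes "\<And>k. 0 \<le> f k" "\<And>k. f k \<le> 1"
  shows "\<bar>f (Suc k) - f k\<bar> \<le> 1"
  using assms[of k] assms[of "Suc k"] by linarith

lemma power_tendsto_0: "(\<lambda>n. c * (1 - mu) ^ n) \<longlonglongrightarrow> 0"
  using mu by (intro tendsto_mult_right_zero LIMSEQ_realpow_zero) auto

lemma limit_law_exists:
  obtains p where
    "\<And>f. (\<And>k. 0 \<le> f k) \<Longrightarrow> (\<And>k. f k \<le> 1) \<Longrightarrow>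
      (\<lambda>n. expect B n f 0) \<longlonglongrightarrow> measure_pmf.expectation p f"
proof (rule uniform_Cauchy_pmf_limit[of "\<lambda>n. ref_steps B n 0" "\<lambda>n. 1 / mu * (1 - mu) ^ n"])
  show "\<bar>expect B m f 0 - expect B n f 0\<bar> \<le> 1 / mu * (1 - mu) ^ n"
    if "\<And>k. 0 \<le> f k" "\<And>k. f k \<le> 1" "n \<le> m" for f m n
    using expect_Cauchy[where f = f, OF unit_increments[of f, OF that(1,2)] that(3)] by simp
qed (use that finite_ref_steps power_tendsto_0[of "1 / mu"] in auto)

lemma stationary_exists: "\<exists>p. is_stationary lam mu B p"
proof -
  obtain p where p: "\<And>f. (\<And>k. 0 \<le> f k) \<Longrightarrow> (\<And>k. f k \<le> 1) \<Longrightarrow>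
      (\<lambda>n. expect B n f 0) \<longlonglongrightarrow> measure_pmf.expectation p f"
    using limit_law_exists[of B] by metis
  have "bind_pmf p (ref_step lam mu B) = p"
  proof (rule pmf_eqI)
    fix k
    \<comment> \<open>The probability of stepping to \<open>k\<close>, as a function of the current state, is a
      \<open>[0, 1]\<close>-valued test function.\<close>
    have "(\<lambda>n. expect B n (\<lambda>i. pmf (ref_step lam mu B i) k) 0) \<longlonglongrightarrow>
        pmf (bind_pmf p (ref_step lam mu B)) k"
      unfolding pmf_bind by (rule p) (auto simp: pmf_le_1)
    moreover have "expect B n (\<lambda>i. pmf (ref_step lam mu B i) k) 0 =
        expect B (Suc n) (indicator {k}) 0" for n
      unfolding ref_steps_Suc' pmf_bind[symmetric] by (simp add: pmf.rep_eq)
    moreover have "(\<lambda>n. expect B (Suc n) (indicator {k}) 0) \<longlonglongrightarrow>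
        measure_pmf.expectation p (indicator {k})"
      by (intro LIMSEQ_Suc p) (auto simp: indicator_def)
    ultimately show "pmf (bind_pmf p (ref_step lam mu B)) k = pmf p k"
      by (auto simp: pmf.rep_eq intro: LIMSEQ_unique)
  qed
  moreover from this have "set_pmf p \<subseteq> buffer_states B"
    using set_pmf_ref_step by (metis (no_types, lifting) UN_least set_bind_pmf)
  ultimately show ?thesis
    unfolding is_stationary_def by blast
qed

lemma stationary_ref_steps:
  assumes "is_stationary lam mu B p"
  shows "bind_pmf p (ref_steps B n) = p"
proof (induction n)
  case 0
  then show ?case
    by (simp add: bind_return_pmf' cong: bind_pmf_cong)
next
  case (Suc n)
  have "bind_pmf p (ref_steps B (Suc n)) = bind_pmf (bind_pmf p (ref_step lam mu B)) (ref_steps B n)"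
    by (simp add: bind_assoc_pmf cong: bind_pmf_cong)
  also have "\<dots> = p"
    using Suc assms by (simp only: is_stationary_def)
  finally show ?case .
qed

text \<open>A stationary law is the limit of the laws started from the empty state: it averages the laws
  started from each state, and by the contraction all of these have the same limit.\<close>

lemma stationary_pmf_limit:
  assumes "is_stationary lam mu B p"
  shows "(\<lambda>n. pmf (ref_steps B n 0) k) \<longlonglongrightarrow> pmf p k"
proof -
  have "(\<lambda>n. measure_pmf.expectation p
      (\<lambda>i. pmf (ref_steps B n i) k - pmf (ref_steps B n 0) k)) \<longlonglongrightarrow> measure_pmf.expectation p (\<lambda>_. 0)"
  proof (rule integral_dominated_convergence[where w = "\<lambda>_. 1"])
    have "(\<lambda>n. pmf (ref_steps B n i) k - pmf (ref_steps B n 0) k) \<longlonglongrightarrow> 0" for i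
    proof (rule Lim_null_comparison[OF _ power_tendsto_0[of "real i"]], rule always_eventually, rule allI)
      fix n
      have "\<bar>expect B n (indicator {k}) i - expect B n (indicator {k}) 0\<bar> \<le> real i * ((1 - mu) ^ n * 1)"
        by (rule expect_initial_state) (auto simp: indicator_def)
      then show "norm (pmf (ref_steps B n i) k - pmf (ref_steps B n 0) k) \<le> real i * (1 - mu) ^ n"
        by (simp add: pmf.rep_eq)
    qed
    then show "AE i in measure_pmf p.
        (\<lambda>n. pmf (ref_steps B n i) k - pmf (ref_steps B n 0) k) \<longlonglongrightarrow> 0"
      by simp
    show "AE i in measure_pmf p. norm (pmf (ref_steps B n i) k - pmf (ref_steps B n 0) k) \<le> 1" for n
      using pmf_le_1 pmf_nonneg by (auto simp: abs_le_iff algebra_simps intro!: AE_pmfI add_increasing2)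
  qed auto
  moreover have "measure_pmf.expectation p (\<lambda>i. pmf (ref_steps B n i) k - pmf (ref_steps B n 0) k) =
      pmf p k - pmf (ref_steps B n 0) k" for n
    by (subst Bochner_Integration.integral_diff)
       (auto simp: integrable_measure_pmf_unit pmf_le_1 stationary_ref_steps[OF assms] simp flip: pmf_bind)
  ultimately have "(\<lambda>n. pmf p k - pmf (ref_steps B n 0) k) \<longlonglongrightarrow> 0"
    by simp
  from tendsto_diff[OF tendsto_const[of "pmf p k"] this] show ?thesis
    by simp
qed

lemma stationary_unique_exists: "\<exists>!p. is_stationary lam mu B p"
  using stationary_exists
  by (metis LIMSEQ_unique pmf_eqI stationary_pmf_limit)

lemma stationary_dist_stationary: "is_stationary lam mu B (stationary_dist lam mu B)"
  unfolding stationary_dist_def by (rule theI'[OF stationary_unique_exists])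

lemma ref_C_limit: "(\<lambda>n. expect B n (indicator {0<..}) 0) \<longlonglongrightarrow> ref_C lam mu B"
proof -
  have "expect B n (indicator {0<..}) 0 = 1 - pmf (ref_steps B n 0) 0" for n
  proof -
    have "{0<..} = UNIV - {0 :: nat}"
      by auto
    then show ?thesis
      using measure_pmf.prob_compl[of "{0}" "ref_steps B n 0"] by (simp add: pmf.rep_eq)
  qed
  then show ?thesis
    unfolding ref_C_def
    by (auto intro!: tendsto_intros stationary_pmf_limit stationary_dist_stationary)
qed

lemma ref_C_mono:
  assumes "B \<le> B'"
  shows "ref_C lam mu B \<le> ref_C lam mu B'"
proof (rule LIMSEQ_le[OF ref_C_limit ref_C_limit])
  have "mono (indicator {0::nat<..} :: nat \<Rightarrow> real)"
    by (auto simp: mono_def indicator_def)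
  then show "\<exists>N. \<forall>n\<ge>N. expect B n (indicator {0<..}) 0 \<le> expect B' n (indicator {0<..}) 0"
    using expect_mono_level assms by blast
qed

lemma ref_C_truncation: "\<bar>ref_C lam mu \<infinity> - ref_C lam mu (enat B)\<bar> \<le> (1 - mu) ^ B / mu"
proof (rule Lim_bounded)
  show "(\<lambda>n. \<bar>expect \<infinity> n (indicator {0<..}) 0 - expect (enat B) n (indicator {0<..}) 0\<bar>)
      \<longlonglongrightarrow> \<bar>ref_C lam mu \<infinity> - ref_C lam mu (enat B)\<bar>"
    by (intro tendsto_intros ref_C_limit)
  have "\<bar>expect \<infinity> n (indicator {0<..}) 0 - expect (enat B) n (indicator {0<..}) 0\<bar>
      \<le> (1 - mu) ^ B * 1 / mu" for n
    by (intro expect_truncation) (auto simp: indicator_def)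
  then show "\<forall>n\<ge>0.
      \<bar>expect \<infinity> n (indicator {0<..}) 0 - expect (enat B) n (indicator {0<..}) 0\<bar> \<le> (1 - mu) ^ B / mu"
    by simp
qed

end


section \<open>Exponential accuracy of the truncation\<close>

theorem theorem2:
  fixes lam mu :: real
  assumes "0 < lam" "lam < 1" "0 < mu" "mu < 1"
  shows "(\<forall>B::enat. 1 \<le> B \<longrightarrow> (\<exists>!p. is_stationary lam mu B p)) \<and>
    (\<exists>\<theta> M :: real. 0 < \<theta> \<and>
       (\<forall>B::nat. 1 \<le> B \<longrightarrow>
          0 \<le> ref_C lam mu \<infinity> - ref_C lam mu (enat B) \<and>
          ref_C lam mu \<infinity> - ref_C lam mu (enat B) \<le> M * exp (- \<theta> * real B))) \<and>
    mono_on {1..} (\<lambda>B::nat. ref_C lam mu (enat B)) \<and>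
    (\<lambda>B::nat. ref_C lam mu (enat B)) \<longlonglongrightarrow> ref_C lam mu \<infinity>"
proof (intro conjI allI impI)
  interpret reference_chain lam mu
    using assms by unfold_locales
  show "\<exists>!p. is_stationary lam mu B p" for B
    by (rule stationary_unique_exists)
  show "\<exists>\<theta> M :: real. 0 < \<theta> \<and>
       (\<forall>B::nat. 1 \<le> B \<longrightarrow>
          0 \<le> ref_C lam mu \<infinity> - ref_C lam mu (enat B) \<and>
          ref_C lam mu \<infinity> - ref_C lam mu (enat B) \<le> M * exp (- \<theta> * real B))"
  proof (intro exI conjI allI impI)
    show "0 < - ln (1 - mu)"
      using assms by simp
    fix B :: nat
    show "0 \<le> ref_C lam mu \<infinity> - ref_C lam mu (enat B)"
      using ref_C_mono[of "enat B" \<infinity>] by simp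
    have "exp (- (- ln (1 - mu)) * real B) = (1 - mu) ^ B"
      using assms by (simp add: exp_of_nat2_mult)
    then show "ref_C lam mu \<infinity> - ref_C lam mu (enat B) \<le> (1 / mu) * exp (- (- ln (1 - mu)) * real B)"
      using ref_C_truncation[of B] by simp
  qed
  show "mono_on {1..} (\<lambda>B::nat. ref_C lam mu (enat B))"
    by (intro mono_onI ref_C_mono) simp
  have "(\<lambda>B. ref_C lam mu (enat B) - ref_C lam mu \<infinity>) \<longlonglongrightarrow> 0"
    by (rule Lim_null_comparison[OF _ power_tendsto_0[of "1 / mu"]])
       (use ref_C_truncation in \<open>simp add: abs_minus_commute\<close>)
  then show "(\<lambda>B::nat. ref_C lam mu (enat B)) \<longlonglongrightarrow> ref_C lam mu \<infinity>"
    by (simp add: LIM_zero_iff)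
qed

end
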